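(* Let $T$ be a tree with bipartition $V(T)=A\cup B$, let $u,v$ be distinct nonadjacent vertices of $T$, and put $H=T+uv$. Then the following are equivalent: (i) $u$ and $v$ lie in the same part of the bipartition of $T$; (ii) $\operatorname{dist}_T(u,v)$ is even; (iii) the unique cycle of $H$ has odd length; (iv) $H$ is non-bipartite. Likewise, the following are equivalent: (i$'$) $u$ and $v$ lie in opposite parts of the bipartition of $T$; (ii$'$) $\operatorname{dist}_T(u,v)$ is odd; (iii$'$) the unique cycle of $H$ has even length; (iv$'$) $H$ is bipartite.
   Context: Graphs are finite and simple. $T+uv$ is $T$ with the edge $uv$ added; it contains exactly one cycle. $\operatorname{dist}_T(u,v)$ is the number of edges of the unique $u$--$v$ path in $T$. *)

theory Defs
  imports "Graph_Theory.Graph_Theory"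
begin

text \<open>
  A finite simple graph is a \<^locale>\<open>pair_graph\<close>: a finite loop-free symmetric digraph without
  parallel arcs, in which an undirected edge \<open>{x, y}\<close> is the pair of arcs \<open>(x, y)\<close>, \<open>(y, x)\<close>.
\<close>

definition uedges :: "'a pair_pre_digraph \<Rightarrow> 'a set set" where
  "uedges G = (\<lambda>(x, y). {x, y}) ` parcs G"

definition add_uedge :: "'a pair_pre_digraph \<Rightarrow> 'a \<Rightarrow> 'a \<Rightarrow> 'a pair_pre_digraph" where
  "add_uedge G u v = \<lparr> pverts = pverts G, parcs = parcs G \<union> {(u, v), (v, u)} \<rparr>"

text \<open>
  In a symmetric digraph, running back and forth along one edge is a directed cycle of length 2.
  The bound \<open>3 \<le> length p\<close> excludes this, and what remains are the closed walks that
  traverse a cycle of the undirected graph.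
  For the same reason the library's \<open>forest\<close> and \<open>tree\<close>, which forbid all
  directed cycles, do not describe undirected forests and trees here.

  The cycle itself is a subgraph, so that walks that differ only in their starting point or
  their direction give the same cycle.
\<close>

definition ucycle :: "'a pair_pre_digraph \<Rightarrow> 'a pair_pre_digraph \<Rightarrow> bool" where
  "ucycle G C \<longleftrightarrow> (\<exists>p. pre_digraph.cycle (with_proj G) p \<and> 3 \<le> length p \<and>
     C = \<lparr> pverts = fst ` set p, parcs = set p \<union> (set p)\<inverse> \<rparr>)"

definition ulength :: "'a pair_pre_digraph \<Rightarrow> nat" where
  "ulength C = card (uedges C)"

text \<open>Meaningful only for a graph that contains exactly one cycle.\<close>

definition the_ucycle :: "'a pair_pre_digraph \<Rightarrow> 'a pair_pre_digraph" where
  "the_ucycle G = (THE C. ucycle G C)"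

definition utree :: "'a pair_pre_digraph \<Rightarrow> bool" where
  "utree T \<longleftrightarrow> pair_graph T \<and> connected (with_proj T) \<and> (\<nexists>C. ucycle T C)"

text \<open>Meaningful only if \<open>T\<close> contains exactly one path from \<open>u\<close> to \<open>v\<close>, as a tree does.\<close>

definition utree_dist :: "'a pair_pre_digraph \<Rightarrow> 'a \<Rightarrow> 'a \<Rightarrow> nat" where
  "utree_dist T u v = length (THE p. pre_digraph.apath (with_proj T) u p v)"

definition bipartition :: "'a pair_pre_digraph \<Rightarrow> 'a set \<Rightarrow> 'a set \<Rightarrow> bool" where
  "bipartition G A B \<longleftrightarrow> A \<union> B = pverts G \<and> A \<inter> B = {} \<and>
     (\<forall>(x, y) \<in> parcs G. (x \<in> A \<and> y \<in> B) \<or> (x \<in> B \<and> y \<in> A))"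

definition bipartite :: "'a pair_pre_digraph \<Rightarrow> bool" where
  "bipartite G \<longleftrightarrow> (\<exists>A B. bipartition G A B)"

end

(*
  The parity of a walk in a bipartite graph tells whether its ends lie in the same part. Adding the
  edge uv closes the unique u-v path of T to a cycle with one more edge. Every cycle of H uses uv,
  since T has none, and what remains of it without uv is a u-v path of T, hence the unique one.
*)
theory Submission
  imports Defs
begin

section \<open>Cycles and paths as lists of arcs\<close>

lemma pawalk_verts_eq_map_snd: "pcas x p y \<Longrightarrow> pawalk_verts x p = x # map snd p"
  by (induct p arbitrary: x) auto

text \<open>Distinctness in a cycle concerns the heads of its arcs. A cyclic shift only permutes
  them, and \<open>snd e\<close> becomes the first vertex once \<open>e\<close> itself is
  dropped.\<close>

lemma (in pair_wf_digraph) cycle_rotate: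
  assumes "cycle q" and "e \<in> set q"
  obtains p where "apath (snd e) p (fst e)" and "set q = insert e (set p)"
    and "length q = Suc (length p)"
proof -
  obtain w where w: "awalk w q w" and d: "distinct (tl (awalk_verts w q))"
    using assms(1) by (auto simp: cycle_def)
  obtain q1 q2 where q: "q = q1 @ e # q2"
    using assms(2) by (meson split_list)
  have w1: "awalk w q1 (fst e)" and w2: "awalk (snd e) q2 w"
    using w by (auto simp: q awalk_Cons_iff)
  have a: "awalk (snd e) (q2 @ q1) (fst e)"
    using w2 w1 by (rule awalk_appendI)
  have "cas w q w" "cas (snd e) (q2 @ q1) (fst e)"
    using w a by blast+
  then have v: "awalk_verts w q = w # map snd q"
    "awalk_verts (snd e) (q2 @ q1) = snd e # map snd (q2 @ q1)"
    by (simp_all only: pawalk_verts_eq_map_snd)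
  have "distinct (awalk_verts (snd e) (q2 @ q1))"
    using d unfolding v by (auto simp: q)
  with a have "apath (snd e) (q2 @ q1) (fst e)"
    by (simp add: apath_def)
  then show thesis
    by (rule that) (auto simp: q)
qed

text \<open>A path does not return to \<open>a\<close> after leaving it through
  \<open>(a, b)\<close> and does not meet \<open>b\<close> before, so \<open>(b, a)\<close> fits on
  neither side. Hence counting arcs of a path is counting undirected edges.\<close>

lemma (in pair_wf_digraph) apath_no_reverse_arc:
  assumes "apath x p y" and "(a, b) \<in> set p"
  shows "(b, a) \<notin> set p"
proof -
  obtain p1 p2 where p: "p = p1 @ (a, b) # p2"
    using assms(2) by (meson split_list)
  have a: "apath x (p1 @ (a, b) # p2) y"
    using assms(1) by (simp add: p)
  then have "awlast x p1 = a"
    by (auto simp: apath_append_iff apath_Cons_iff)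
  with a have 1: "apath x p1 a" and 2: "apath b p2 y" "a \<notin> set (awalk_verts b p2)"
    and disj: "set (awalk_verts x p1) \<inter> set (awalk_verts b p2) = {}" and "a \<noteq> b"
    by (auto simp: apath_append_iff apath_Cons_iff dest: hd_in_awalk_verts(2))
  have "(b, a) \<notin> set p2"
    using 2 awalk_verts_arc2[of b p2 y "(b, a)"] by (auto simp: apath_def)
  moreover have "(b, a) \<notin> set p1"
    using awalk_verts_arc1[of "(b, a)" p1 x] disj hd_in_awalk_verts(2)[OF 2(1)] by auto
  ultimately show ?thesis
    using \<open>a \<noteq> b\<close> by (simp add: p)
qed

lemma (in pair_wf_digraph) inj_on_uedge_apath:
  assumes "apath x p y"
  shows "inj_on (\<lambda>(a, b). {a, b}) (set p)"
  using apath_no_reverse_arc[OF assms] by (auto simp: inj_on_def doubleton_eq_iff)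

section \<open>Reversal and uniqueness of paths\<close>

lemma length_rev_path: "length (rev_path p) = length p"
  by (induct p) auto

lemma set_rev_path: "set (rev_path p) = (set p)\<inverse>"
  by (induct p) auto

text \<open>Shortening \<open>r\<close> to a path adds no arcs. As \<open>a\<close> and
  \<open>b\<close> differ and \<open>(b, a)\<close> is excluded, the path has at least two arcs, so
  closing it with \<open>(a, b)\<close> meets the bound 3 in \<open>ucycle\<close>.\<close>

lemma (in pair_graph) ucycle_if_two_connections:
  assumes "(a, b) \<in> parcs G" and "awalk b r a"
    and "(a, b) \<notin> set r" and "(b, a) \<notin> set r"
  shows "\<exists>C. ucycle G C"
proof -
  define s where "s = awalk_to_apath r"
  have s: "apath b s a" and sub: "set s \<subseteq> set r"
    using assms(2) by (auto simp: s_def apath_awalk_to_apath dest: awalk_to_apath_subset)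
  have "a \<noteq> b"
    using assms(1) by (auto dest: no_loops')
  have "2 \<le> length s"
  proof (rule ccontr)
    assume "\<not> ?thesis"
    then consider "s = []" | e where "s = [e]"
      by (cases s rule: list_exhaust_NSC) auto
    then show False
      using s \<open>a \<noteq> b\<close> assms(4) sub by cases (auto simp: apath_simps)
  qed
  moreover have "cycle ((a, b) # s)"
    using s assms(1) unfolding cycle_def apath_def
    by (intro exI[of _ a]) (auto simp: awalk_Cons_iff)
  ultimately show ?thesis
    unfolding ucycle_def by fastforce
qed

text \<open>Two paths with the same ends must begin with the same arc, as otherwise the first edge
  of one of them lies on a cycle. Induction handles the rest.\<close>

lemma (in pair_graph) apath_unique:
  assumes "\<nexists>C. ucycle G C" and "apath x p y" and "apath x q y"
  shows "p = q"
  using assms(2,3)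
proof (induction p arbitrary: q x)
  case Nil
  then show ?case
    by (metis apath_Nil_iff apath_nonempty_ends)
next
  case (Cons e p)
  then obtain f q' where q: "q = f # q'"
    by (metis apath_nonempty_ends apath_Nil_iff list.distinct(1) neq_Nil_conv)
  obtain a b where e: "e = (x, a)" and f: "f = (x, b)"
    using Cons.prems by (cases e; cases f) (auto simp: q apath_Cons_iff)
  have p': "apath a p y" "x \<notin> set (awalk_verts a p)" "(x, a) \<in> parcs G"
    and q': "apath b q' y" "x \<notin> set (awalk_verts b q')"
    using Cons.prems by (auto simp: q e f apath_Cons_iff)
  have "a = b"
  proof (rule ccontr)
    assume "a \<noteq> b"
    \<comment> \<open>\<open>p\<close> followed by \<open>q\<close> backwards leads from \<open>a\<close> to \<open>x\<close> without using the edge \<open>xa\<close>.\<close>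
    have "awalk a (p @ rev_path q) x"
      using p'(1) Cons.prems(2) by (intro awalk_appendI[of _ _ y]) (auto simp: apath_def)
    \<comment> \<open>No arc of \<open>p\<close> or \<open>q'\<close> touches \<open>x\<close>, and
      the remaining edge \<open>xb\<close> of \<open>q\<close> differs from
      \<open>xa\<close>.\<close>
    moreover have "(x, a) \<notin> set p" "(a, x) \<notin> set p"
      using awalk_verts_arc1[of "(x, a)" p a] awalk_verts_arc2[of a p y "(a, x)"] p'
      by (auto simp: apath_def)
    moreover have "(x, a) \<notin> set q'" "(a, x) \<notin> set q'"
      using awalk_verts_arc1[of "(x, a)" q' b] awalk_verts_arc2[of b q' y "(a, x)"] q'
      by (auto simp: apath_def)
    moreover have "x \<noteq> b"
      using q' by (auto dest: hd_in_awalk_verts(2))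
    ultimately show False
      using ucycle_if_two_connections[OF p'(3), of "p @ rev_path q"] assms(1) \<open>a \<noteq> b\<close>
      by (auto simp: q f set_rev_path)
  qed
  then show ?case
    using Cons.IH[OF p'(1)] q'(1) by (simp add: q e f)
qed

section \<open>Parity of walks in bipartite graphs\<close>

lemma bipartition_walk_parity:
  assumes "pair_wf_digraph G" and "bipartition G A B" and "pre_digraph.awalk (with_proj G) x p y"
  shows "(x \<in> A \<longleftrightarrow> y \<in> A) \<longleftrightarrow> even (length p)"
proof -
  interpret pair_wf_digraph G by fact
  have arc: "a \<in> A \<longleftrightarrow> b \<notin> A" if "(a, b) \<in> parcs G" for a b
    using assms(2) that by (fastforce simp: bipartition_def)
  show ?thesis
    using assms(3)
  proof (induction p arbitrary: x)
    case Nil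
    then show ?case by (auto simp: awalk_Nil_iff)
  next
    case (Cons e p)
    then show ?case
      using arc[of "fst e" "snd e"] by (auto simp: awalk_Cons_iff)
  qed
qed

section \<open>Paths and distances in trees\<close>

lemma utree_pair_graph: "utree T \<Longrightarrow> pair_graph T"
  by (simp add: utree_def)

lemma utree_apath_unique:
  assumes "utree T" and "pre_digraph.apath (with_proj T) x p y"
    and "pre_digraph.apath (with_proj T) x q y"
  shows "p = q"
  using pair_graph.apath_unique[OF utree_pair_graph[OF assms(1)] _ assms(2,3)] assms(1)
  by (simp add: utree_def)

lemma utree_apath_exists:
  assumes "utree T" and "x \<in> pverts T" and "y \<in> pverts T"
  obtains p where "pre_digraph.apath (with_proj T) x p y"
proof -
  interpret pair_graph T using assms(1) by (rule utree_pair_graph)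
  \<comment> \<open>\<open>connected\<close> speaks of reachability after symmetrizing the arcs;
    here they are symmetric already.\<close>
  have "strongly_connected (with_proj T)"
    using assms(1) symmetric_connected_imp_strongly_connected[OF pair_sym_arcs]
    by (simp add: utree_def)
  then have "\<exists>p. apath x p y"
    using assms(2,3) reachable_apath[of x y] by (simp add: strongly_connected_def)
  then show thesis
    using that by blast
qed

lemma utree_dist_eq:
  assumes "utree T" and "pre_digraph.apath (with_proj T) x p y"
  shows "utree_dist T x y = length p"
  using assms utree_apath_unique[OF assms(1)] unfolding utree_dist_def
  by (metis (no_types, lifting) the_equality)

section \<open>The cycle created by an added edge\<close>

lemma pair_graph_add_uedge:
  assumes "pair_graph T" and "u \<in> pverts T" and "v \<in> pverts T" and "u \<noteq> v"
  shows "pair_graph (add_uedge T u v)"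
proof -
  interpret pair_graph T by fact
  have "sym (parcs T)"
    using pair_sym_arcs by (simp add: symmetric_def)
  then have "sym (parcs T \<union> {(u, v), (v, u)})"
    by (rule sym_Un) (simp add: sym_def)
  then show ?thesis
    using assms(2-4) pair_finite_verts pair_finite_arcs
    by unfold_locales
      (auto simp: add_uedge_def symmetric_def wellformed' dest: no_loops')
qed

lemma awalk_add_uedge_iff:
  assumes "(u, v) \<notin> set p" and "(v, u) \<notin> set p"
  shows "pre_digraph.awalk (with_proj (add_uedge T u v)) x p y \<longleftrightarrow>
    pre_digraph.awalk (with_proj T) x p y"
  using assms by (auto simp: pre_digraph.awalk_def add_uedge_def cas_with_proj_eq)

lemma apath_add_uedge_iff:
  assumes "(u, v) \<notin> set p" and "(v, u) \<notin> set p"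
  shows "pre_digraph.apath (with_proj (add_uedge T u v)) x p y \<longleftrightarrow>
    pre_digraph.apath (with_proj T) x p y"
  using awalk_add_uedge_iff[OF assms]
  by (simp add: pre_digraph.apath_def awalk_verts_with_proj_eq)

lemma add_uedge_commute: "add_uedge T u v = add_uedge T v u"
  by (auto simp: add_uedge_def)

text \<open>Removing \<open>(u, v)\<close> leaves a path from \<open>v\<close> to \<open>u\<close>
  with at least two arcs. Its first arc ends before \<open>u\<close> is reached and its later arcs
  avoid \<open>v\<close>, so it does not use the new edge and lies in \<open>T\<close>.\<close>

lemma add_uedge_cycle_path:
  assumes "pair_graph (add_uedge T u v)"
    and "pre_digraph.cycle (with_proj (add_uedge T u v)) q" and "3 \<le> length q"
    and "(u, v) \<in> set q"
  obtains p where "pre_digraph.apath (with_proj T) v p u" and "set q = insert (u, v) (set p)"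
proof -
  interpret H: pair_graph "add_uedge T u v" by fact
  obtain p where p: "H.apath v p u" and q: "set q = insert (u, v) (set p)"
    and len: "2 \<le> length p"
  proof -
    obtain p where "H.apath v p u" "set q = insert (u, v) (set p)" "length q = Suc (length p)"
      using H.cycle_rotate[OF assms(2,4)] by auto
    then show thesis
      using that assms(3) by simp
  qed
  obtain f p' where f: "p = f # p'" "p' \<noteq> []"
    using len by (cases p rule: list_exhaust_NSC) auto
  have fst_f: "fst f = v" "H.apath (snd f) p' u" "v \<notin> set (H.awalk_verts (snd f) p')"
    using p by (auto simp: f H.apath_Cons_iff)
  have "snd f \<noteq> u"
    using H.apath_nonempty_ends[OF fst_f(2) f(2)] .
  moreover have "(v, u) \<notin> set p'" "(u, v) \<notin> set p'"
    using H.awalk_verts_arc1[of "(v, u)" p' "snd f"] fst_f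
      H.awalk_verts_arc2[of "snd f" p' u "(u, v)"] by (auto simp: H.apath_def)
  moreover have "u \<noteq> v"
    using H.apath_nonempty_ends[OF p] by (auto simp: f)
  ultimately have "(u, v) \<notin> set p" "(v, u) \<notin> set p"
    using fst_f(1) by (cases f, auto simp: f)+
  then show thesis
    using that p q apath_add_uedge_iff by metis
qed

text \<open>Both sides are the vertex set of the path. This matches the vertex sets of a cycle
  traversed in the two directions.\<close>

lemma (in pair_wf_digraph) apath_fst_snd_image:
  assumes "apath x p y"
  shows "insert y (fst ` set p) = insert x (snd ` set p)"
proof (cases "p = []")
  case True
  then show ?thesis using assms by (simp add: apath_Nil_iff)
next
  case False
  have c: "cas x p y" and l: "awlast x p = y"
    using assms by (auto simp: apath_def)
  have "set (awalk_verts x p) = insert y (fst ` set p)"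
    using l False by (auto simp: awalk_verts_conv)
  moreover have "set (awalk_verts x p) = insert x (snd ` set p)"
    by (simp add: pawalk_verts_eq_map_snd[OF c])
  ultimately show ?thesis by simp
qed

text \<open>Existence and uniqueness in one equation: the right side is fixed by \<open>p\<close>,
  so the \<open>THE\<close> in \<open>the_ucycle\<close> can be evaluated by rewriting.\<close>

lemma ucycle_add_uedge:
  assumes "utree T" and "u \<in> pverts T" and "v \<in> pverts T" and "u \<noteq> v" and "(u, v) \<notin> parcs T"
    and p: "pre_digraph.apath (with_proj T) v p u"
  shows "ucycle (add_uedge T u v) C \<longleftrightarrow>
    C = \<lparr> pverts = insert u (fst ` set p),
          parcs = insert (u, v) (set p) \<union> (insert (u, v) (set p))\<inverse> \<rparr>"
    (is "?L \<longleftrightarrow> C = ?C")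
proof -
  interpret T: pair_graph T using assms(1) by (rule utree_pair_graph)
  have gH: "pair_graph (add_uedge T u v)"
    using T.pair_graph assms(2-4) by (rule pair_graph_add_uedge)
  interpret H: pair_graph "add_uedge T u v" by (rule gH)
  have vu: "(v, u) \<notin> parcs T"
    using assms(5) T.arcs_symmetric by blast
  have "set p \<subseteq> parcs T"
    using p by (auto simp: T.apath_def)
  then have np: "(u, v) \<notin> set p" "(v, u) \<notin> set p"
    using assms(5) vu by auto
  have "?L" if "C = ?C"
  proof -
    \<comment> \<open>A single arc from \<open>v\<close> to \<open>u\<close> would be the missing
      edge.\<close>
    have "2 \<le> length p"
    proof (rule ccontr)
      assume "\<not> ?thesis"
      then consider "p = []" | e where "p = [e]"
        by (cases p rule: list_exhaust_NSC) auto
      then show False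
        using p \<open>u \<noteq> v\<close> np by cases (auto simp: T.apath_simps)
    qed
    moreover have "H.apath v p u" "(u, v) \<in> parcs (add_uedge T u v)"
      using p np by (simp add: apath_add_uedge_iff, simp add: add_uedge_def)
    then have "H.cycle ((u, v) # p)"
      unfolding H.cycle_def H.apath_def by (intro exI[of _ u]) (simp add: H.awalk_Cons_iff)
    ultimately show ?thesis
      unfolding ucycle_def that by (intro exI[of _ "(u, v) # p"]) auto
  qed
  moreover have "C = ?C" if C_cycle: ?L
  proof -
    obtain q where q: "H.cycle q" "3 \<le> length q"
      and C: "C = \<lparr> pverts = fst ` set q, parcs = set q \<union> (set q)\<inverse> \<rparr>"
      using C_cycle by (auto simp: ucycle_def)
    consider "(u, v) \<in> set q" | "(v, u) \<in> set q" | "(u, v) \<notin> set q" "(v, u) \<notin> set q"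
      by blast
    then show ?thesis
    proof cases
      case 1
      obtain p' where "T.apath v p' u" and "set q = insert (u, v) (set p')"
        using add_uedge_cycle_path[OF gH q 1] .
      then show ?thesis
        using utree_apath_unique[OF assms(1) p] by (auto simp: C)
    next
      case 2
      obtain p' where p': "T.apath u p' v" and set_q: "set q = insert (v, u) (set p')"
        using add_uedge_cycle_path[of T v u q] gH q 2 by (metis add_uedge_commute)
      \<comment> \<open>The cycle runs through the new edge backwards, so its arcs are the converse
        of those in \<open>?C\<close>, and the symmetric closure is the same.\<close>
      have "p' = rev_path p"
        using utree_apath_unique[OF assms(1) p'] p by simp
      then have "set q = (insert (u, v) (set p))\<inverse>"
        by (auto simp: set_q set_rev_path)
      moreover have "fst ` (insert (u, v) (set p))\<inverse> = insert v (snd ` set p)"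
        by force
      ultimately show ?thesis
        using T.apath_fst_snd_image[OF p] by (simp add: C Un_commute)
    next
      case 3
      then have "T.cycle q"
        using q(1) unfolding H.cycle_def T.cycle_def by (simp add: awalk_add_uedge_iff)
      then have "ucycle T C"
        using q(2) C unfolding ucycle_def by blast
      then show ?thesis
        using assms(1) by (auto simp: utree_def)
    qed
  qed
  ultimately show ?thesis by blast
qed

text \<open>Thus the symmetric closure in \<open>ucycle\<close> does not affect the number of
  edges.\<close>

lemma uedge_image_symcl:
  "(\<lambda>(x, y). {x, y}) ` (S \<union> S\<inverse>) = (\<lambda>(x, y). {x, y}) ` S"
proof -
  have "{x, y} \<in> (\<lambda>(x, y). {x, y}) ` S" if "(y, x) \<in> S" for x y
    using imageI[OF that, of "\<lambda>(x, y). {x, y}"] by (simp add: insert_commute)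
  then show ?thesis
    by (auto simp del: image_eqI)
qed

text \<open>The arcs of the path give pairwise different edges, and the new edge is not among them;
  it accounts for the \<open>Suc\<close>.\<close>

lemma ulength_the_ucycle_add_uedge:
  assumes "utree T" and "u \<in> pverts T" and "v \<in> pverts T" and "u \<noteq> v" and "(u, v) \<notin> parcs T"
  shows "ulength (the_ucycle (add_uedge T u v)) = Suc (utree_dist T u v)"
proof -
  interpret T: pair_graph T using assms(1) by (rule utree_pair_graph)
  obtain p where p: "T.apath v p u"
    using utree_apath_exists[OF assms(1,3,2)] .
  define E where "E = (\<lambda>(x::'a, y). {x, y})"
  have "uedges (the_ucycle (add_uedge T u v)) = E ` insert (u, v) (set p)"
    unfolding the_ucycle_def ucycle_add_uedge[OF assms p] the_eq_trivial uedges_def E_def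
    by (simp only: pair_pre_digraph.simps uedge_image_symcl)
  then have "ulength (the_ucycle (add_uedge T u v)) = card (insert {u, v} (E ` set p))"
    by (simp add: ulength_def E_def)
  moreover have "{u, v} \<notin> E ` set p"
  proof -
    have "(u, v) \<notin> set p" "(v, u) \<notin> set p"
      using p assms(5) T.arcs_symmetric[of v u] by (auto simp: T.apath_def T.awalk_def)
    then show ?thesis by (auto simp: E_def doubleton_eq_iff)
  qed
  moreover have "card (E ` set p) = length p"
    using T.inj_on_uedge_apath[OF p] T.distinct_verts_imp_distinct p
    by (auto simp: E_def card_image distinct_card T.apath_def)
  \<comment> \<open>\<open>p\<close> runs from \<open>v\<close> to \<open>u\<close>, so the distance
    is read off its reversal.\<close>
  moreover have "utree_dist T u v = length p"
    using utree_dist_eq[OF assms(1), of u "rev_path p"] p by (simp add: length_rev_path)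
  ultimately show ?thesis by simp
qed

section \<open>Bipartitions and the equivalences\<close>

lemma bipartition_add_uedge_iff:
  "bipartition (add_uedge T u v) A B \<longleftrightarrow>
    bipartition T A B \<and> (u \<in> A \<and> v \<in> B \<or> u \<in> B \<and> v \<in> A)"
  by (auto simp: bipartition_def add_uedge_def)

lemma utree_same_part_iff:
  assumes "utree T" and "bipartition T A B" and "u \<in> pverts T" and "v \<in> pverts T"
  shows "(u \<in> A \<longleftrightarrow> v \<in> A) \<longleftrightarrow> even (utree_dist T u v)"
proof -
  interpret T: pair_graph T using assms(1) by (rule utree_pair_graph)
  obtain p where p: "T.apath u p v"
    using utree_apath_exists[OF assms(1,3,4)] .
  then show ?thesis
    using bipartition_walk_parity[OF T.pair_wf_digraph assms(2)] utree_dist_eq[OF assms(1) p]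
    by (simp add: T.apath_def)
qed

theorem proposition2p8:
  fixes T H :: "'a pair_pre_digraph" and A B :: "'a set" and u v :: 'a
  assumes "utree T"
    and "bipartition T A B"
    and "u \<in> pverts T" and "v \<in> pverts T"
    and "u \<noteq> v" and "(u, v) \<notin> parcs T"
    and "H = add_uedge T u v"
  shows "(((u \<in> A \<and> v \<in> A) \<or> (u \<in> B \<and> v \<in> B)) \<longleftrightarrow> even (utree_dist T u v)) \<and>
         (even (utree_dist T u v) \<longleftrightarrow> odd (ulength (the_ucycle H))) \<and>
         (odd (ulength (the_ucycle H)) \<longleftrightarrow> \<not> bipartite H) \<and>
         (((u \<in> A \<and> v \<in> B) \<or> (u \<in> B \<and> v \<in> A)) \<longleftrightarrow> odd (utree_dist T u v)) \<and>
         (odd (utree_dist T u v) \<longleftrightarrow> even (ulength (the_ucycle H))) \<and>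
         (even (ulength (the_ucycle H)) \<longleftrightarrow> bipartite H)"
proof -
  have parts: "w \<in> B' \<longleftrightarrow> w \<notin> A'" if "bipartition T A' B'" "w \<in> pverts T" for A' B' w
    using that by (auto simp: bipartition_def)
  \<comment> \<open>This is stated for every bipartition of \<open>T\<close>, since the one that
    witnesses \<open>bipartite H\<close> is arbitrary. For the converse, the given \<open>A\<close>
    and \<open>B\<close> serve as witnesses.\<close>
  have opposite: "(u \<in> A' \<and> v \<in> B' \<or> u \<in> B' \<and> v \<in> A') \<longleftrightarrow> odd (utree_dist T u v)"
    if "bipartition T A' B'" for A' B'
    using utree_same_part_iff[OF assms(1) that assms(3,4)] parts[OF that] assms(3,4) by blast
  have "bipartite H \<longleftrightarrow> odd (utree_dist T u v)"
    using opposite assms(2) unfolding bipartite_def assms(7) bipartition_add_uedge_iff by blast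
  moreover have "ulength (the_ucycle H) = Suc (utree_dist T u v)"
    unfolding assms(7) by (rule ulength_the_ucycle_add_uedge[OF assms(1,3-6)])
  ultimately show ?thesis
    using opposite[OF assms(2)] parts[OF assms(2)] assms(3,4) by auto
qed

end
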